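(* Assume that $P$ and $P^{\mathrm t}P$ are irreducible and that at least one coarse state contains more than one fine state. Let $1\le k<N$, and let $\theta\in[0,\pi/2]$ be the angle associated with $k$ defined by $\sin(\theta)=\lVert(I-\Pi(\mu)^{\mathrm t})Q^{\mathrm t}\rVert_\mu$. Then $$\rho(J(\mu))^2\le\lVert(I-\Pi(\mu))J(\mu)\rVert_{1/\mu}^2\le 1-\frac{1}{\lVert(I-\Pi(\mu))(I-\hat P^{\ast,1/\mu}\hat P)^{-1}(I-\Pi(\mu))\rVert_{1/\mu}}\le 1-\frac{1}{\sin^2(\theta)\frac{1}{1-\lambda_2}+\cos^2(\theta)\frac{1}{1-\lambda_{k+1}}}.$$
   Context: Setting. $P\in\mathbb R^{N\times N}$ is column stochastic (nonnegative entries, each column sums to one) and irreducible; $\mu\in\mathbb R^N$ is its unique steady-state probability vector, $P\mu=\mu$ (all entries of $\mu$ are positive). $\Omega=\{1,\dots,N\}$ is partitioned into disjoint nonempty sets $S_1,\dots,S_n$, called coarse states; elements of $\Omega$ are fine states. $\mathbf 1$ is the all-ones vector, $I$ the identity, $M^{\mathrm t}$ the transpose, $\rho$ the spectral radius. $A:\mathbb R^N\to\mathbb R^n$, $(A\nu)_i=\sum_{x\in S_i}\nu_x$. $D(\mu):\mathbb R^n\to\mathbb R^N$, $(D(\mu)z)_j=z_i\,\mu_j/(A\mu)_i$ where $i$ is the index with $j\in S_i$. $\hat P=P-\mu\mathbf 1^{\mathrm t}$, $\Pi(\mu)=D(\mu)A$, $S(\mu)=D(\mu)[A(I-P+\mu\mathbf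 1^{\mathrm t})D(\mu)]^{-1}A(I-P+\mu\mathbf 1^{\mathrm t})$ (the inverted matrix is indeed invertible), $J(\mu)=\hat P(I-S(\mu))$. For $w\in\mathbb R^N$ with positive entries, $\langle x,y\rangle_w=\sum_ix_iy_iw_i$, $\lVert x\rVert_w=\langle x,x\rangle_w^{1/2}$, $\lVert M\rVert_w$ is the induced operator norm, and $M^{\ast,w}$ is the adjoint of $M$ with respect to $\langle\cdot,\cdot\rangle_w$; $1/\mu$ is the entrywise reciprocal and $\operatorname{diag}(w)$ the diagonal matrix with diagonal $w$. The matrix $P^{\ast,1/\mu}P$ is self-adjoint and positive semidefinite for $\langle\cdot,\cdot\rangle_{1/\mu}$, with eigenvalues $1=\lambda_1\ge\lambda_2\ge\dots\ge\lambda_N\ge0$ (with multiplicity). Let $v_1=\mu,v_2,\dots,v_N$ be a corresponding basis of right eigenvectors, orthonormal for $\langle\cdot,\cdot\rangle_{1/\mu}$, and $v_i'=\operatorname{diag}(1/\mu)v_i$ (so $v_1'=\mathbf 1$). For the given $k$, $Q=\mu\mathbf 1^{\mathrm t}+\sum_{i=2}^kv_i(v_i')^{\mathrm t}$ is the $\langle\cdot,\cdot\rangle_{1/\mu}$-orthogonal projection onto the span of $v_1,\dots,v_k$. One has $0\le\lVert(I-\Pi(\mu)^{\mathrm t})Q^{\mathrm t}\rVert_\mu\le1$ (norm weighted by $\mu$, not $1/\mu$), so $\theta$ is well defined. *)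

theory Defs
  imports "HOL-Analysis.Analysis"
begin

definition column_stochastic :: "real^'n^'n \<Rightarrow> bool" where
  "column_stochastic P \<longleftrightarrow> (\<forall>i j. 0 \<le> P $ i $ j) \<and> (\<forall>j. (\<Sum>i\<in>UNIV. P $ i $ j) = 1)"

text \<open>Irreducibility means that the directed graph of nonzero entries is strongly connected.
  Using the transitive closure, every index lies on a cycle, so the 1-by-1 zero matrix does
  not count as irreducible.\<close>

definition irreducible_matrix :: "real^'n^'n \<Rightarrow> bool" where
  "irreducible_matrix M \<longleftrightarrow> {(i, j). M $ i $ j \<noteq> 0}\<^sup>+ = UNIV"

definition outer :: "real^'m \<Rightarrow> real^'n \<Rightarrow> real^'n^'m" where
  "outer x y = (\<chi> i j. x $ i * y $ j)"

definition diag :: "real^'n \<Rightarrow> real^'n^'n" where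
  "diag w = (\<chi> i j. if i = j then w $ i else 0)"

definition recip :: "real^'n \<Rightarrow> real^'n" where
  "recip w = (\<chi> i. 1 / w $ i)"

text \<open>The eigenvalues of a real matrix are taken over the complex numbers.\<close>

definition spectrum :: "real^'n^'n \<Rightarrow> complex set" where
  "spectrum M = {z. \<exists>u :: complex^'n. u \<noteq> 0 \<and> (\<chi> i j. complex_of_real (M $ i $ j)) *v u = z *s u}"

definition spectral_radius :: "real^'n^'n \<Rightarrow> real" where
  "spectral_radius M = Max (cmod ` spectrum M)"

definition winner :: "real^'n \<Rightarrow> real^'n \<Rightarrow> real^'n \<Rightarrow> real" where
  "winner w x y = (\<Sum>i\<in>UNIV. x $ i * y $ i * w $ i)"

definition wnorm :: "real^'n \<Rightarrow> real^'n \<Rightarrow> real" where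
  "wnorm w x = sqrt (winner w x x)"

text \<open>As in \<^const>\<open>onorm\<close>, the zero vector contributes the harmless quotient
  \<open>0 / 0 = 0\<close>.\<close>

definition wonorm :: "real^'n \<Rightarrow> real^'n^'n \<Rightarrow> real" where
  "wonorm w M = (SUP x. wnorm w (M *v x) / wnorm w x)"

definition wadjoint :: "real^'n \<Rightarrow> real^'n^'n \<Rightarrow> real^'n^'n" where
  "wadjoint w M = (THE M'. \<forall>x y. winner w (M *v x) y = winner w x (M' *v y))"

text \<open>For positive weights the adjoint exists uniquely, so the description above is proper.\<close>

lemma wadjoint_eq:
  fixes w :: "real^'n" and M :: "real^'n^'n"
  assumes w: "\<And>i. 0 < w $ i"
  shows "wadjoint w M = (\<chi> i j. M $ j $ i * w $ j / w $ i)"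
  unfolding wadjoint_def
proof (rule the_equality)
  show "\<forall>x y. winner w (M *v x) y = winner w x ((\<chi> i j. M $ j $ i * w $ j / w $ i) *v y)"
  proof (intro allI)
    fix x y :: "real^'n"
    have "winner w (M *v x) y = (\<Sum>i\<in>UNIV. \<Sum>j\<in>UNIV. M $ i $ j * x $ j * y $ i * w $ i)"
      by (simp add: winner_def matrix_vector_mult_def sum_distrib_right)
    also have "\<dots> = (\<Sum>j\<in>UNIV. \<Sum>i\<in>UNIV. M $ i $ j * x $ j * y $ i * w $ i)"
      by (rule sum.swap)
    also have "\<dots> = winner w x ((\<chi> i j. M $ j $ i * w $ j / w $ i) *v y)"
      using w by (simp add: winner_def matrix_vector_mult_def sum_distrib_left sum_distrib_right
          less_imp_neq [symmetric] ac_simps)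
    finally show "winner w (M *v x) y
      = winner w x ((\<chi> i j. M $ j $ i * w $ j / w $ i) *v y)" .
  qed
next
  fix M' :: "real^'n^'n"
  assume adj: "\<forall>x y. winner w (M *v x) y = winner w x (M' *v y)"
  have "M' $ i $ j = M $ j $ i * w $ j / w $ i" for i j
  proof -
    have "winner w (M *v axis i 1) (axis j 1) = winner w (axis i 1) (M' *v axis j 1)"
      using adj by blast
    then have "M $ j $ i * w $ j = M' $ i $ j * w $ i"
      by (simp add: winner_def matrix_vector_mult_def axis_def if_distrib if_distribR
          cong: if_cong)
    then show ?thesis
      using w [of i] by (simp add: field_simps)
  qed
  then show "M' = (\<chi> i j. M $ j $ i * w $ j / w $ i)"
    by (simp add: vec_eq_iff)
qed

text \<open>The fine states are the elements of \<open>'n\<close>, the coarse states are the sets \<open>S i\<close> for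
  \<open>i :: 'm\<close>.\<close>

definition coarse_states :: "('m \<Rightarrow> 'n set) \<Rightarrow> bool" where
  "coarse_states S \<longleftrightarrow> disjoint_family S \<and> (\<forall>i. S i \<noteq> {}) \<and> (\<Union>i. S i) = UNIV"

definition aggr :: "('m \<Rightarrow> 'n set) \<Rightarrow> real^'n^'m" where
  "aggr S = (\<chi> i x. if x \<in> S i then 1 else 0)"

definition disaggr :: "('m \<Rightarrow> 'n set) \<Rightarrow> real^'n \<Rightarrow> real^'m^'n" where
  "disaggr S \<mu> = (\<chi> j i. if j \<in> S i then \<mu> $ j / (aggr S *v \<mu>) $ i else 0)"

lemma aggr_mult: "(aggr S *v \<nu>) $ i = (\<Sum>x\<in>S i. \<nu> $ x)"
  by (simp add: aggr_def matrix_vector_mult_def if_distrib if_distribR sum.If_cases cong: if_cong)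

lemma disaggr_mult:
  assumes "coarse_states S" and j: "j \<in> S i"
  shows "(disaggr S \<mu> *v z) $ j = z $ i * \<mu> $ j / (aggr S *v \<mu>) $ i"
proof -
  have "j \<in> S i' \<longleftrightarrow> i' = i" for i'
    using assms unfolding coarse_states_def disjoint_family_on_def by blast
  then show ?thesis
    by (simp add: disaggr_def matrix_vector_mult_def if_distrib if_distribR cong: if_cong)
qed

definition P_hat :: "real^'n^'n \<Rightarrow> real^'n \<Rightarrow> real^'n^'n" where
  "P_hat P \<mu> = P - outer \<mu> 1"

definition Pi_mat :: "('m::finite \<Rightarrow> 'n set) \<Rightarrow> real^'n \<Rightarrow> real^'n^'n" where
  "Pi_mat S \<mu> = disaggr S \<mu> ** aggr S"

definition S_mat :: "('m::finite \<Rightarrow> 'n set) \<Rightarrow> real^'n^'n \<Rightarrow> real^'n \<Rightarrow> real^'n^'n" where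
  "S_mat S P \<mu> =
     disaggr S \<mu> ** matrix_inv (aggr S ** (mat 1 - P + outer \<mu> 1) ** disaggr S \<mu>)
       ** aggr S ** (mat 1 - P + outer \<mu> 1)"

definition J_mat :: "('m::finite \<Rightarrow> 'n set) \<Rightarrow> real^'n^'n \<Rightarrow> real^'n \<Rightarrow> real^'n^'n" where
  "J_mat S P \<mu> = P_hat P \<mu> ** (mat 1 - S_mat S P \<mu>)"

text \<open>The indices of \<open>lam\<close> and \<open>v\<close> run over \<open>1, \<dots>, N\<close> where \<open>N = CARD('n)\<close>; values at other
  indices are irrelevant.  Since \<open>N\<close> orthonormal vectors form a basis, each eigenvalue occurs
  in \<open>lam\<close> according to its multiplicity.\<close>

definition ordered_eigenbasis ::
    "real^'n \<Rightarrow> real^'n^'n \<Rightarrow> (nat \<Rightarrow> real) \<Rightarrow> (nat \<Rightarrow> real^'n) \<Rightarrow> bool" where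
  "ordered_eigenbasis w M lam v \<longleftrightarrow>
     (\<forall>i\<in>{1..CARD('n)}. M *v v i = lam i *\<^sub>R v i) \<and>
     (\<forall>i\<in>{1..CARD('n)}. \<forall>j\<in>{1..CARD('n)}. winner w (v i) (v j) = (if i = j then 1 else 0)) \<and>
     (\<forall>i\<in>{1..CARD('n)}. \<forall>j\<in>{1..CARD('n)}. i \<le> j \<longrightarrow> lam j \<le> lam i)"

definition Q_mat :: "real^'n \<Rightarrow> (nat \<Rightarrow> real^'n) \<Rightarrow> nat \<Rightarrow> real^'n^'n" where
  "Q_mat \<mu> v k = outer \<mu> 1 + (\<Sum>i=2..k. outer (v i) (diag (recip \<mu>) *v v i))"

end

theory Submission
  imports Defs "HOL-Computational_Algebra.Polynomial"
begin

text \<open>Write \<open>K\<close> for \<open>P_hat P \<mu>\<close>, \<open>E\<close> for \<open>I - \<Pi>(\<mu>)\<close>, \<open>T\<close> for \<open>I - S(\<mu>)\<close>, so that \<open>J = K T\<close>, and measure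
  lengths with the weight \<open>1/\<mu>\<close>.  Then \<open>E\<close> is an orthogonal projection, and \<open>K\<close> strictly decreases
  the length of every nonzero vector: subtracting \<open>\<mu> 1\<^sup>t\<close> removes the stationary component, and
  on the rest \<open>\<parallel>x\<parallel>\<^sup>2 - \<parallel>P x\<parallel>\<^sup>2\<close> is a Dirichlet form whose edges are the nonzero entries of
  \<open>P\<^sup>t P\<close>, so irreducibility of \<open>P\<^sup>t P\<close> makes it vanish on multiples of \<open>\<mu>\<close> only
  (\<open>dirichlet_form\<close>, \<open>P_hat_strict_contraction\<close>).  In particular \<open>B = I - K\<^sup>* K\<close> is positive
  definite, and the coarse operator inverted in \<open>S(\<mu>)\<close> is invertible.

  First inequality.  The correction kills coarse vectors, \<open>T \<Pi> = 0\<close>, hence \<open>J E = J\<close>, and \<open>J\<close> and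
  \<open>E J\<close> have the same nonzero eigenvalues; each of these is bounded by the operator norm of
  \<open>E J\<close> (\<open>spectral_radius_le_wonorm_mult\<close>).

  Second inequality.  The correction leaves the fine part alone, \<open>E T = E\<close>, and solves the coarse
  equation, \<open>\<Pi> K T = \<Pi> T\<close>.  With \<open>y = T x\<close> and \<open>z = E x = E y\<close>, applying Pythagoras twice gives
  \<open>\<parallel>E K y\<parallel>\<^sup>2 = \<parallel>K y\<parallel>\<^sup>2 - \<parallel>\<Pi> y\<parallel>\<^sup>2 = \<parallel>z\<parallel>\<^sup>2 - \<langle>B y, y\<rangle>\<close>.  Since \<open>\<parallel>z\<parallel>\<^sup>2 = \<langle>z, y\<rangle> = \<langle>B (B\<^sup>-\<^sup>1 z), y\<rangle>\<close>, the
  Cauchy-Schwarz inequality for the form of \<open>B\<close> bounds \<open>\<langle>B y, y\<rangle>\<close> from below by \<open>\<parallel>z\<parallel>\<^sup>2 / c\<close>, where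
  \<open>c\<close> is the norm of \<open>E B\<^sup>-\<^sup>1 E\<close> (\<open>energy_lower_bound\<close>, \<open>wonorm_coarse_corrected_le\<close>).

  Third inequality.  As \<open>E B\<^sup>-\<^sup>1 E\<close> is symmetric and positive semidefinite, \<open>c\<close> is controlled by
  \<open>\<langle>B\<^sup>-\<^sup>1 z, z\<rangle>\<close> for \<open>z\<close> in the range of \<open>E\<close>.  Such a \<open>z\<close> is orthogonal to \<open>\<mu>\<close>, and on the orthogonal
  complement of \<open>\<mu>\<close> the eigenvectors \<open>v\<^sub>i\<close> diagonalise \<open>B\<close> with eigenvalues \<open>1 - \<lambda>\<^sub>i\<close>.  The share
  of \<open>\<parallel>z\<parallel>\<^sup>2\<close> carried by \<open>v\<^sub>1, \<dots>, v\<^sub>k\<close> is \<open>\<parallel>Q z\<parallel>\<^sup>2 = \<parallel>Q E z\<parallel>\<^sup>2 \<le> sin\<^sup>2 \<theta> \<parallel>z\<parallel>\<^sup>2\<close>, because transposition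
  exchanges the norms for \<open>1/\<mu>\<close> and \<open>\<mu>\<close> (\<open>wnorm_recip_mult_le\<close>, \<open>gap_inverse_form_le\<close>).\<close>

section \<open>Inverse matrices and weighted inner products\<close>

lemma
  fixes M :: "'a::semiring_1^'n^'m"
  assumes "invertible M"
  shows matrix_inv_right: "M ** matrix_inv M = mat 1"
    and matrix_inv_left: "matrix_inv M ** M = mat 1"
  using someI_ex [OF assms [unfolded invertible_def]] by (auto simp: matrix_inv_def)

lemma winner_commute: "winner w x y = winner w y x"
  by (simp add: winner_def ac_simps)

lemma winner_add_left: "winner w (x + y) z = winner w x z + winner w y z"
  by (simp add: winner_def algebra_simps sum.distrib)

lemma winner_diff_left: "winner w (x - y) z = winner w x z - winner w y z"
  by (simp add: winner_def algebra_simps sum_subtractf)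

lemma winner_scaleR_left: "winner w (c *\<^sub>R x) z = c * winner w x z"
  by (simp add: winner_def algebra_simps sum_distrib_left)

lemma winner_add_right: "winner w z (x + y) = winner w z x + winner w z y"
  by (simp add: winner_def algebra_simps sum.distrib)

lemma winner_diff_right: "winner w z (x - y) = winner w z x - winner w z y"
  by (simp add: winner_def algebra_simps sum_subtractf)

lemma winner_scaleR_right: "winner w z (c *\<^sub>R x) = c * winner w z x"
  by (simp add: winner_def algebra_simps sum_distrib_left)

lemma winner_sum_left: "winner w (\<Sum>i\<in>I. f i) z = (\<Sum>i\<in>I. winner w (f i) z)"
  by (induction I rule: infinite_finite_induct)
    (simp_all add: winner_add_left, simp_all add: winner_def)

lemmas winner_linear = winner_add_left winner_diff_left winner_scaleR_left
  winner_add_right winner_diff_right winner_scaleR_right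

lemma winner_zero [simp]: "winner w 0 x = 0" "winner w x 0 = 0"
  by (simp_all add: winner_def)

lemma wnorm_zero [simp]: "wnorm w 0 = 0"
  by (simp add: wnorm_def)

text \<open>Degenerate forms are included because one use of the inequality is for compressions such as
  \<open>E B\<^sup>-\<^sup>1 E\<close>, which have a kernel.\<close>

lemma symmetric_form_Cauchy_Schwarz:
  fixes G :: "real^'n^'n"
  assumes sym: "\<And>x y. winner w (G *v x) y = winner w x (G *v y)"
    and psd: "\<And>x. 0 \<le> winner w (G *v x) x"
  shows "(winner w (G *v x) y)\<^sup>2 \<le> winner w (G *v x) x * winner w (G *v y) y"
proof -
  define xx yy xy where "xx = winner w (G *v x) x" and "yy = winner w (G *v y) y"
    and "xy = winner w (G *v x) y"
  have yx: "winner w (G *v y) x = xy"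
    unfolding xy_def by (metis sym winner_commute)
  have form: "0 \<le> a\<^sup>2 * xx + 2 * a * b * xy + b\<^sup>2 * yy" for a b
    using psd [of "a *\<^sub>R x + b *\<^sub>R y"] yx
    by (simp add: winner_linear matrix_vector_right_distrib matrix_vector_mult_scaleR
        flip: xx_def yy_def xy_def) (simp add: algebra_simps power2_eq_square)
  have nonneg: "0 \<le> xx" "0 \<le> yy"
    unfolding xx_def yy_def by (rule psd)+
  have "xy\<^sup>2 \<le> xx * yy"
  proof (cases "yy = 0")
    case False
    \<comment> \<open>The weights minimise the form along the line through \<open>x\<close> in direction \<open>y\<close>, up to scaling.\<close>
    have "0 \<le> yy * (xx * yy - xy\<^sup>2)"
      using form [of yy "- xy"] by (simp add: algebra_simps power2_eq_square)
    then show ?thesis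
      using False nonneg by (simp add: zero_le_mult_iff)
  next
    case True
    show ?thesis
    proof (rule ccontr)
      assume "\<not> xy\<^sup>2 \<le> xx * yy"
      then have pos: "0 < xy\<^sup>2"
        using True by simp
      show False
        \<comment> \<open>As \<open>yy = 0\<close>, the form is affine along \<open>x + b y\<close>; this \<open>b\<close> gives it the value \<open>- xx - 2\<close>.\<close>
        using form [of 1 "- (xx + 1) / xy"] True pos nonneg by simp
    qed
  qed
  then show ?thesis
    by (simp add: xx_def yy_def xy_def)
qed

locale positive_weight =
  fixes w :: "real^'n"
  assumes weight_pos: "0 < w $ i"
begin

text \<open>An isometry onto the Euclidean space; through it the library facts on \<^const>\<open>onorm\<close> and on
  orthogonal sets carry over to the weighted setting.\<close>

definition rescale :: "real^'n \<Rightarrow> real^'n" where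
  "rescale x = (\<chi> i. sqrt (w $ i) * x $ i)"

lemma winner_eq_inner: "winner w x y = rescale x \<bullet> rescale y"
  using weight_pos by (simp add: winner_def rescale_def inner_vec_def less_imp_le algebra_simps
      flip: real_sqrt_mult)

lemma linear_rescale: "linear rescale"
  by (rule linearI) (simp_all add: rescale_def vec_eq_iff algebra_simps)

lemma wnorm_eq_norm: "wnorm w x = norm (rescale x)"
  by (simp add: wnorm_def winner_eq_inner norm_eq_sqrt_inner)

lemma bij_rescale: "bij rescale"
proof (rule o_bij)
  show "(\<lambda>y. \<chi> i. y $ i / sqrt (w $ i)) \<circ> rescale = id"
    using weight_pos by (auto simp: fun_eq_iff rescale_def vec_eq_iff less_imp_neq [symmetric])
  show "rescale \<circ> (\<lambda>y. \<chi> i. y $ i / sqrt (w $ i)) = id"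
    using weight_pos by (auto simp: fun_eq_iff rescale_def vec_eq_iff less_imp_neq [symmetric])
qed

lemma rescale_eq_0_iff: "rescale x = 0 \<longleftrightarrow> x = 0"
  using linear_0 [OF linear_rescale] bij_rescale by (metis bij_pointE)

lemma wnorm_nonneg [simp]: "0 \<le> wnorm w x"
  by (simp add: wnorm_eq_norm)

lemma wnorm_pos_iff: "0 < wnorm w x \<longleftrightarrow> x \<noteq> 0"
  by (simp add: wnorm_eq_norm rescale_eq_0_iff)

lemma wnorm_power2: "(wnorm w x)\<^sup>2 = winner w x x"
  by (simp add: wnorm_eq_norm winner_eq_inner dot_square_norm)

lemma winner_self_nonneg [simp]: "0 \<le> winner w x x"
  by (simp flip: wnorm_power2)

lemma winner_self_pos_iff: "0 < winner w x x \<longleftrightarrow> x \<noteq> 0"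
  by (metis wnorm_power2 wnorm_pos_iff wnorm_nonneg zero_less_power2 less_le)

lemma Cauchy_Schwarz_winner: "winner w x y \<le> wnorm w x * wnorm w y"
  by (simp add: winner_eq_inner wnorm_eq_norm norm_cauchy_schwarz)

lemma wonorm_eq_onorm: "wonorm w M = onorm (\<lambda>y. rescale (M *v inv rescale y))"
proof -
  have "range (\<lambda>x. wnorm w (M *v x) / wnorm w x)
    = (\<lambda>y. norm (rescale (M *v inv rescale y)) / norm y) ` range rescale"
    using bij_rescale by (simp add: image_image wnorm_eq_norm bij_is_inj)
  also have "range rescale = UNIV"
    using bij_rescale by (simp add: bij_is_surj)
  finally show ?thesis
    by (simp add: wonorm_def onorm_def)
qed

lemma bounded_linear_rescaled: "bounded_linear (\<lambda>y. rescale (M *v inv rescale y))"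
proof -
  have "linear (inv rescale)"
    using bij_rescale linear_rescale by (simp add: bij_is_inj inj_linear_imp_inv_linear)
  then have "linear (rescale \<circ> (*v) M \<circ> inv rescale)"
    by (intro linear_compose linear_rescale matrix_vector_mul_linear)
  then show ?thesis
    by (simp add: linear_conv_bounded_linear o_def)
qed

lemma wnorm_mult_le: "wnorm w (M *v x) \<le> wonorm w M * wnorm w x"
  using onorm [OF bounded_linear_rescaled, of M "rescale x"] bij_rescale
  by (simp add: wonorm_eq_onorm wnorm_eq_norm bij_is_inj)

lemma wonorm_nonneg [simp]: "0 \<le> wonorm w M"
  unfolding wonorm_eq_onorm by (rule onorm_pos_le [OF bounded_linear_rescaled])

lemma wonorm_le:
  assumes "0 \<le> c" and "\<And>x. wnorm w (M *v x) \<le> c * wnorm w x"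
  shows "wonorm w M \<le> c"
  unfolding wonorm_def
proof (rule cSUP_least)
  fix x
  show "wnorm w (M *v x) / wnorm w x \<le> c"
    using assms by (cases "x = 0") (simp_all add: wnorm_pos_iff divide_le_eq)
qed simp

lemma winner_wadjoint: "winner w (M *v x) y = winner w x (wadjoint w M *v y)"
proof -
  have "winner w (M *v x) y = (\<Sum>i\<in>UNIV. \<Sum>j\<in>UNIV. M $ i $ j * x $ j * y $ i * w $ i)"
    by (simp add: winner_def matrix_vector_mult_def sum_distrib_right)
  also have "\<dots> = (\<Sum>j\<in>UNIV. \<Sum>i\<in>UNIV. M $ i $ j * x $ j * y $ i * w $ i)"
    by (rule sum.swap)
  also have "\<dots> = winner w x (wadjoint w M *v y)"
    using weight_pos by (simp add: wadjoint_eq winner_def matrix_vector_mult_def sum_distrib_left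
        sum_distrib_right less_imp_neq [symmetric] ac_simps)
  finally show ?thesis .
qed

text \<open>Parseval's identity: as many orthonormal vectors as the dimension span the space.\<close>

lemma orthonormal_expansion:
  assumes orth: "\<forall>i\<in>{1..CARD('n)}. \<forall>j\<in>{1..CARD('n)}. winner w (e i) (e j) = (if i = j then 1 else 0)"
  shows "winner w x y = (\<Sum>i=1..CARD('n). winner w x (e i) * winner w y (e i))"
proof -
  define b where "b i = rescale (e i)" for i
  have b: "b i \<bullet> b j = (if i = j then 1 else 0)" if "i \<in> {1..CARD('n)}" "j \<in> {1..CARD('n)}" for i j
    using orth that by (simp add: b_def flip: winner_eq_inner)
  have inj: "inj_on b {1..CARD('n)}"
    by (rule inj_onI) (metis b zero_neq_one)
  define B where "B = b ` {1..CARD('n)}"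
  have orthB: "pairwise orthogonal B"
    by (auto simp: B_def pairwise_def orthogonal_def b split: if_splits)
  have "0 \<notin> B"
    using b by (force simp: B_def)
  with orthB have "independent B"
    by (rule pairwise_orthogonal_independent)
  moreover have "card B = dim (UNIV :: (real^'n) set)"
    using inj by (simp add: B_def card_image)
  ultimately have span: "span B = UNIV"
    using card_eq_dim [of B UNIV] by (auto simp: B_def)
  have expand: "a = (\<Sum>i=1..CARD('n). (b i \<bullet> a) *\<^sub>R b i)" for a
  proof -
    have "a = (\<Sum>c\<in>B. (c \<bullet> a / (c \<bullet> c)) *\<^sub>R c)"
      using Gram_Schmidt_step [OF orthB, of "a - (\<Sum>c\<in>B. (c \<bullet> a / (c \<bullet> c)) *\<^sub>R c)" a] span
      by (simp add: orthogonal_self)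
    also have "\<dots> = (\<Sum>i=1..CARD('n). (b i \<bullet> a / (b i \<bullet> b i)) *\<^sub>R b i)"
      unfolding B_def sum.reindex [OF inj] by simp
    also have "\<dots> = (\<Sum>i=1..CARD('n). (b i \<bullet> a) *\<^sub>R b i)"
      by (rule sum.cong) (simp_all add: b)
    finally show ?thesis .
  qed
  have "rescale x \<bullet> rescale y = (\<Sum>i=1..CARD('n). (b i \<bullet> rescale x) *\<^sub>R b i) \<bullet> rescale y"
    by (subst expand [of "rescale x"]) simp
  also have "\<dots> = (\<Sum>i=1..CARD('n). (rescale x \<bullet> b i) * (rescale y \<bullet> b i))"
    by (simp add: inner_sum_left inner_commute [of _ "b _"])
  finally show ?thesis
    by (simp add: winner_eq_inner b_def)
qed

text \<open>Division by \<open>w\<close> is an isometry from the weight \<open>1/w\<close> to the weight \<open>w\<close>, and it carries the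
  adjoint for the former to the transpose acting on the latter.  This is why the angle, defined
  by transposes and the weight \<open>\<mu>\<close>, controls an operator measured with the weight \<open>1/\<mu>\<close>.\<close>

lemma wnorm_recip_mult_le:
  "wnorm (recip w) (M *v x) \<le> wonorm w (transpose M) * wnorm (recip w) x"
proof -
  interpret rec: positive_weight "recip w"
    by unfold_locales (simp add: recip_def weight_pos)
  have w0 [simp]: "w $ i \<noteq> 0" for i
    using weight_pos [of i] by simp
  define d where "d y = (\<chi> i. y $ i / w $ i)" for y
  have norm_d: "wnorm w (d y) = wnorm (recip w) y" for y
    by (simp add: wnorm_def winner_def d_def recip_def)
  have inner_d: "winner (recip w) x y = x \<bullet> d y" "winner w (d x) y = x \<bullet> y" for x y
    by (simp_all add: winner_def d_def recip_def inner_vec_def)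
  define y where "y = M *v x"
  have "(wnorm (recip w) y)\<^sup>2 = (M *v x) \<bullet> d y"
    by (simp add: rec.wnorm_power2 inner_d y_def)
  also have "\<dots> = x \<bullet> (transpose M *v d y)"
    by (simp add: inner_commute [of x] dot_lmul_matrix) (rule inner_commute)
  also have "\<dots> = winner w (d x) (transpose M *v d y)"
    by (simp add: inner_d)
  also have "\<dots> \<le> wnorm w (d x) * (wonorm w (transpose M) * wnorm w (d y))"
    by (rule order_trans [OF Cauchy_Schwarz_winner mult_left_mono [OF wnorm_mult_le wnorm_nonneg]])
  finally have "wnorm (recip w) y * wnorm (recip w) y
      \<le> (wonorm w (transpose M) * wnorm (recip w) x) * wnorm (recip w) y"
    by (simp add: norm_d power2_eq_square ac_simps)
  then show ?thesis
    by (cases "y = 0") (simp_all add: mult_le_cancel_right rec.wnorm_pos_iff flip: y_def)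
qed

end

section \<open>Eigenvalues and the weighted operator norm\<close>

definition complexify :: "real^'n^'m \<Rightarrow> complex^'n^'m" where
  "complexify M = (\<chi> i j. complex_of_real (M $ i $ j))"

lemma complexify_mult: "complexify (A ** B) = complexify A ** complexify B"
  by (simp add: complexify_def matrix_matrix_mult_def vec_eq_iff)

lemma mem_spectrum_iff: "z \<in> spectrum M \<longleftrightarrow> (\<exists>u. u \<noteq> 0 \<and> complexify M *v u = z *s u)"
  by (simp add: spectrum_def complexify_def)

text \<open>If \<open>u\<close> is an eigenvector of \<open>J = J E\<close>, then \<open>E u\<close> is one of \<open>E J\<close>; it cannot vanish, as otherwise
  \<open>J u = J (E u) = 0\<close>.\<close>

lemma nonzero_spectrum_mult_subset:
  assumes "J ** E = J" and "z \<in> spectrum J" and "z \<noteq> 0"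
  shows "z \<in> spectrum (E ** J)"
proof -
  obtain u where u: "u \<noteq> 0" "complexify J *v u = z *s u"
    using assms(2) by (auto simp: mem_spectrum_iff)
  define y where "y = complexify E *v u"
  have Jy: "complexify J *v y = z *s u"
    using u(2) assms(1) by (metis complexify_mult matrix_vector_mul_assoc y_def)
  have "complexify (E ** J) *v y = complexify E *v (complexify J *v y)"
    by (simp only: complexify_mult matrix_vector_mul_assoc)
  also have "\<dots> = z *s y"
    by (simp only: Jy vec.scale) (simp only: y_def)
  finally show ?thesis
    using u(1) Jy assms(3) unfolding mem_spectrum_iff
    by (metis matrix_vector_mult_0_right vector_mul_eq_0)
qed

text \<open>The spectral radius is a maximum and so has a meaning only for a finite spectrum.  The
  spectrum is the zero set of the characteristic polynomial; a bound on the spectrum exhibits a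
  point where this polynomial does not vanish.\<close>

lemma finite_spectrum_if_bounded:
  assumes bound: "\<And>z. z \<in> spectrum M \<Longrightarrow> cmod z \<le> c"
  shows "finite (spectrum (M :: real^'n^'n))"
proof -
  define ent where "ent i j = [:- complex_of_real (M $ i $ j), if i = j then 1 else 0:]" for i j
  define p where "p = (\<Sum>\<sigma> | \<sigma> permutes (UNIV :: 'n set).
      of_int (sign \<sigma>) * (\<Prod>i\<in>UNIV. ent i (\<sigma> i)))"
  have char: "poly p z = det (mat z - complexify M)" for z
  proof -
    have "poly (ent i j) z = (mat z - complexify M) $ i $ j" for i j
      by (simp add: ent_def mat_def complexify_def)
    then show ?thesis
      by (simp add: p_def det_def poly_sum poly_prod)
  qed
  have root: "poly p z = 0 \<longleftrightarrow> z \<in> spectrum M" for z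
  proof -
    have "mat z *v u = z *s u" for u :: "complex^'n"
      by (simp add: mat_def matrix_vector_mult_def vec_eq_iff if_distrib if_distribR cong: if_cong)
    then have "(mat z - complexify M) *v u = 0 \<longleftrightarrow> complexify M *v u = z *s u" for u
      by (metis eq_iff_diff_eq_0 matrix_vector_mult_diff_rdistrib)
    moreover have "poly p z \<noteq> 0 \<longleftrightarrow> (\<forall>u. (mat z - complexify M) *v u = 0 \<longrightarrow> u = 0)"
      by (simp only: char invertible_left_inverse matrix_left_invertible_ker flip: invertible_det_nz)
    ultimately show ?thesis
      by (auto simp: mem_spectrum_iff)
  qed
  have "of_real (\<bar>c\<bar> + 1) \<notin> spectrum M"
    using bound by fastforce
  then have "p \<noteq> 0"
    using root by force
  then have "finite {z. poly p z = 0}"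
    by (rule poly_roots_finite)
  then show ?thesis
    by (simp add: root)
qed

lemma real_eigenvalue_in_spectrum:
  assumes "M *v x = c *\<^sub>R x" and "x \<noteq> 0"
  shows "complex_of_real c \<in> spectrum M"
proof -
  define u where "u = (\<chi> i. complex_of_real (x $ i))"
  have "(\<Sum>j\<in>UNIV. M $ i $ j * x $ j) = c * x $ i" for i
    using assms(1) by (simp add: vec_eq_iff matrix_vector_mult_def)
  then have "(\<Sum>j\<in>UNIV. complex_of_real (M $ i $ j) * complex_of_real (x $ j))
      = complex_of_real c * complex_of_real (x $ i)" for i
    by (simp flip: of_real_mult of_real_sum)
  then have "complexify M *v u = complex_of_real c *s u"
    by (simp add: vec_eq_iff u_def complexify_def matrix_vector_mult_def)
  moreover have "u \<noteq> 0"
    using assms(2) by (simp add: u_def vec_eq_iff)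
  ultimately show ?thesis
    by (auto simp: mem_spectrum_iff)
qed

context positive_weight
begin

text \<open>A complex eigenvector \<open>a + i b\<close> satisfies
  \<open>\<parallel>M a\<parallel>\<^sup>2 + \<parallel>M b\<parallel>\<^sup>2 = \<bar>z\<bar>\<^sup>2 (\<parallel>a\<parallel>\<^sup>2 + \<parallel>b\<parallel>\<^sup>2)\<close>, so the norm over the real vectors is enough.\<close>

lemma spectrum_le_wonorm:
  assumes "z \<in> spectrum M"
  shows "cmod z \<le> wonorm w M"
proof -
  obtain u where u: "u \<noteq> 0" "complexify M *v u = z *s u"
    using assms by (auto simp: mem_spectrum_iff)
  define a b where "a = (\<chi> i. Re (u $ i))" and "b = (\<chi> i. Im (u $ i))"
  have Mu: "(\<Sum>j\<in>UNIV. of_real (M $ i $ j) * u $ j) = z * u $ i" for i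
    using u(2) by (simp add: vec_eq_iff complexify_def matrix_vector_mult_def)
  have Ma: "(M *v a) $ i = Re (z * u $ i)" and Mb: "(M *v b) $ i = Im (z * u $ i)" for i
    using Mu [of i] by (auto simp add: a_def b_def matrix_vector_mult_def simp flip: Mu)
  have norm_sq: "(Re (z * x))\<^sup>2 + (Im (z * x))\<^sup>2 = (cmod z)\<^sup>2 * ((Re x)\<^sup>2 + (Im x)\<^sup>2)" for x
    by (metis cmod_power2 norm_mult power_mult_distrib)
  define s where "s = winner w a a + winner w b b"
  have "winner w (M *v a) (M *v a) + winner w (M *v b) (M *v b)
    = (\<Sum>i\<in>UNIV. ((Re (z * u $ i))\<^sup>2 + (Im (z * u $ i))\<^sup>2) * w $ i)"
    by (simp only: winner_def Ma Mb power2_eq_square distrib_right sum.distrib)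
  also have "\<dots> = (\<Sum>i\<in>UNIV. (cmod z)\<^sup>2 * ((Re (u $ i))\<^sup>2 + (Im (u $ i))\<^sup>2) * w $ i)"
    by (simp only: norm_sq)
  also have "\<dots> = (cmod z)\<^sup>2 * s"
    by (simp add: s_def winner_def a_def b_def sum_distrib_left power2_eq_square algebra_simps
        sum.distrib)
  finally have eq: "(cmod z)\<^sup>2 * s = (wnorm w (M *v a))\<^sup>2 + (wnorm w (M *v b))\<^sup>2"
    by (simp add: wnorm_power2)
  also have "\<dots> \<le> (wonorm w M * wnorm w a)\<^sup>2 + (wonorm w M * wnorm w b)\<^sup>2"
    by (intro add_mono power_mono wnorm_mult_le wnorm_nonneg)
  also have "\<dots> = (wonorm w M)\<^sup>2 * s"
    by (simp add: power_mult_distrib wnorm_power2 s_def algebra_simps)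
  finally have "(cmod z)\<^sup>2 * s \<le> (wonorm w M)\<^sup>2 * s" .
  moreover have "0 < s"
  proof -
    have "a \<noteq> 0 \<or> b \<noteq> 0"
      using u(1) by (auto simp: a_def b_def vec_eq_iff complex_eq_iff)
    then show ?thesis
      unfolding s_def using winner_self_pos_iff winner_self_nonneg
      by (metis add_nonneg_pos add_pos_nonneg)
  qed
  ultimately show ?thesis
    by (simp add: mult_le_cancel_right power2_le_iff_abs_le)
qed

lemma finite_spectrum: "finite (spectrum (M :: real^'n^'n))"
  using finite_spectrum_if_bounded spectrum_le_wonorm by blast

lemma spectral_radius_le_wonorm_mult:
  assumes "J ** E = J" and "spectrum J \<noteq> {}"
  shows "spectral_radius J \<le> wonorm w (E ** J)"
proof -
  have "cmod z \<le> wonorm w (E ** J)" if "z \<in> spectrum J" for z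
    using that assms(1) by (cases "z = 0") (simp_all add: nonzero_spectrum_mult_subset spectrum_le_wonorm)
  then show ?thesis
    using assms(2) unfolding spectral_radius_def by (subst Max_le_iff) (auto simp: finite_spectrum)
qed

lemma spectral_radius_nonneg:
  fixes J :: "real^'n^'n"
  assumes "spectrum J \<noteq> {}"
  shows "0 \<le> spectral_radius J"
proof -
  obtain z where "z \<in> spectrum J"
    using assms by blast
  then have "cmod z \<le> spectral_radius J"
    unfolding spectral_radius_def by (intro Max_ge) (auto simp: finite_spectrum)
  then show ?thesis
    by (rule order_trans [OF norm_ge_zero])
qed

end

section \<open>The contraction estimate for a coarse correction\<close>

context positive_weight
begin

text \<open>The operator norm of a positive semidefinite symmetric operator is governed by its quadratic
  form: the Cauchy-Schwarz inequality for the form at \<open>x\<close> and \<open>G x\<close> bounds \<open>\<parallel>G x\<parallel>\<^sup>4\<close>.\<close>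

lemma symmetric_wonorm_le:
  assumes sym: "\<And>x y. winner w (G *v x) y = winner w x (G *v y)"
    and psd: "\<And>x. 0 \<le> winner w (G *v x) x"
    and bound: "\<And>x. winner w (G *v x) x \<le> c * winner w x x" and "0 \<le> c"
  shows "wonorm w G \<le> c"
proof (rule wonorm_le [OF \<open>0 \<le> c\<close>])
  fix x
  define a b where "a = wnorm w x" and "b = wnorm w (G *v x)"
  have "(b\<^sup>2)\<^sup>2 \<le> winner w (G *v x) x * winner w (G *v (G *v x)) (G *v x)"
    using symmetric_form_Cauchy_Schwarz [OF sym psd, of x "G *v x"]
    by (simp add: b_def wnorm_power2)
  also have "\<dots> \<le> (c * a\<^sup>2) * (c * b\<^sup>2)"
    using bound [of x] bound [of "G *v x"] psd \<open>0 \<le> c\<close>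
    by (intro mult_mono) (simp_all add: a_def b_def wnorm_power2)
  finally have "b\<^sup>2 * b\<^sup>2 \<le> (c * a)\<^sup>2 * b\<^sup>2"
    by (simp add: algebra_simps power2_eq_square)
  moreover have "0 \<le> b" "0 \<le> c * a"
    using \<open>0 \<le> c\<close> by (simp_all add: a_def b_def)
  ultimately have "b \<le> c * a"
    by (cases "b = 0") (simp_all only: mult_le_cancel_right power2_le_iff_abs_le, auto)
  then show "wnorm w (G *v x) \<le> c * wnorm w x"
    by (simp add: a_def b_def)
qed

text \<open>The operator called \<open>B\<close> in the introduction; its quadratic form is \<open>\<parallel>x\<parallel>\<^sup>2 - \<parallel>K x\<parallel>\<^sup>2\<close>.\<close>

definition gap :: "real^'n^'n \<Rightarrow> real^'n^'n" where
  "gap K = mat 1 - wadjoint w K ** K"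

lemma winner_gap_left: "winner w (gap K *v x) y = winner w x y - winner w (K *v x) (K *v y)"
  and winner_gap_right: "winner w x (gap K *v y) = winner w x y - winner w (K *v x) (K *v y)"
proof -
  show *: "winner w x (gap K *v y) = winner w x y - winner w (K *v x) (K *v y)" for x y
    by (simp add: gap_def matrix_vector_mult_diff_rdistrib winner_diff_right winner_wadjoint
        flip: matrix_vector_mul_assoc)
  show "winner w (gap K *v x) y = winner w x y - winner w (K *v x) (K *v y)"
    using * [of y x] by (simp add: winner_commute)
qed

context
  fixes K :: "real^'n^'n"
  assumes strict: "\<And>x. x \<noteq> 0 \<Longrightarrow> wnorm w (K *v x) < wnorm w x"
begin

lemma gap_pos_def: "x \<noteq> 0 \<Longrightarrow> 0 < winner w (gap K *v x) x"
  using power_strict_mono [OF strict, of x 2] by (simp add: winner_gap_left wnorm_power2)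

lemma gap_nonneg: "0 \<le> winner w (gap K *v x) x"
  using gap_pos_def [of x] by (cases "x = 0") (simp_all add: less_imp_le)

lemma invertible_gap: "invertible (gap K)"
proof -
  have "\<forall>x. gap K *v x = 0 \<longrightarrow> x = 0"
    using gap_pos_def by (metis less_irrefl winner_zero(1))
  then show ?thesis
    by (simp add: invertible_left_inverse matrix_left_invertible_ker)
qed

lemma gap_inverse: "gap K *v (matrix_inv (gap K) *v x) = x"
  by (simp add: matrix_vector_mul_assoc matrix_inv_right invertible_gap)

lemma winner_gap_inverse_commute:
  "winner w (matrix_inv (gap K) *v x) y = winner w x (matrix_inv (gap K) *v y)"
  by (metis gap_inverse winner_gap_left winner_gap_right)

lemma gap_inverse_pos_def: "x \<noteq> 0 \<Longrightarrow> 0 < winner w (matrix_inv (gap K) *v x) x"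
  by (metis gap_inverse gap_pos_def matrix_vector_mult_0_right winner_commute)

context
  fixes E :: "real^'n^'n"
  assumes proj_sym: "\<And>x y. winner w (E *v x) y = winner w x (E *v y)"
    and proj_idem: "\<And>x. E *v (E *v x) = E *v x"
begin

lemma wnorm_proj_le: "wnorm w (E *v x) \<le> wnorm w x"
proof -
  have "(wnorm w (E *v x))\<^sup>2 = winner w x (E *v x)"
    by (metis proj_idem proj_sym wnorm_power2)
  also have "\<dots> \<le> wnorm w x * wnorm w (E *v x)"
    by (rule Cauchy_Schwarz_winner)
  finally show ?thesis
    by (cases "E *v x = 0") (simp_all add: power2_eq_square mult_le_cancel_right wnorm_pos_iff)
qed

abbreviation compressed_inverse :: "real^'n^'n" where
  "compressed_inverse \<equiv> E ** matrix_inv (gap K) ** E"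

lemma winner_compressed_inverse:
  "winner w (compressed_inverse *v x) y = winner w (matrix_inv (gap K) *v (E *v x)) (E *v y)"
  by (simp add: proj_sym flip: matrix_vector_mul_assoc)

lemma compressed_inverse_wonorm_pos:
  assumes "E *v z \<noteq> 0"
  shows "0 < wonorm w compressed_inverse"
proof -
  have "0 < winner w (compressed_inverse *v z) z"
    by (simp add: winner_compressed_inverse gap_inverse_pos_def assms)
  then have "compressed_inverse *v z \<noteq> 0"
    by (metis less_irrefl winner_zero(1))
  then have "0 < wnorm w (compressed_inverse *v z)"
    by (simp add: wnorm_pos_iff)
  with wnorm_mult_le [of compressed_inverse z] show ?thesis
    by (metis less_le_trans wonorm_nonneg less_le mult_zero_left not_less)
qed

text \<open>With \<open>z = E y\<close> and \<open>u = B\<^sup>-\<^sup>1 z\<close> one has \<open>\<parallel>z\<parallel>\<^sup>2 = \<langle>z, y\<rangle> = \<langle>B u, y\<rangle>\<close>, and the Cauchy-Schwarz inequality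
  for the form of \<open>B\<close> separates \<open>u\<close> from \<open>y\<close>.\<close>

lemma energy_lower_bound:
  "(winner w (E *v y) (E *v y))\<^sup>2
    \<le> wonorm w compressed_inverse * winner w (E *v y) (E *v y) * winner w (gap K *v y) y"
proof -
  define z where "z = E *v y"
  define u where "u = matrix_inv (gap K) *v z"
  have "winner w z z = winner w z y"
    unfolding z_def by (metis proj_idem proj_sym)
  then have "(winner w z z)\<^sup>2 = (winner w (gap K *v u) y)\<^sup>2"
    by (simp add: u_def gap_inverse)
  also have "\<dots> \<le> winner w (gap K *v u) u * winner w (gap K *v y) y"
    by (rule symmetric_form_Cauchy_Schwarz [OF _ gap_nonneg])
      (simp add: winner_gap_left winner_gap_right)
  also have "winner w (gap K *v u) u = winner w u z"
    by (simp add: u_def gap_inverse winner_commute)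
  also have "\<dots> = winner w (compressed_inverse *v z) z"
    by (simp add: winner_compressed_inverse u_def z_def proj_idem)
  also have "winner w (compressed_inverse *v z) z \<le> wonorm w compressed_inverse * winner w z z"
    using order_trans [OF Cauchy_Schwarz_winner mult_right_mono [OF wnorm_mult_le wnorm_nonneg]]
    by (simp add: power2_eq_square flip: wnorm_power2) (simp add: algebra_simps)
  finally show ?thesis
    using gap_nonneg [of y] by (simp add: z_def mult_right_mono)
qed

text \<open>The two hypotheses on \<open>T\<close> say that it leaves the fine part of a vector unchanged and that
  \<open>y = T x\<close> satisfies the coarse equations \<open>\<Pi> K y = \<Pi> y\<close>, where \<open>\<Pi> = I - E\<close>.  The second one turns
  the length lost by projecting \<open>K y\<close> into the length of the coarse part of \<open>y\<close>.\<close>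

lemma wonorm_coarse_corrected_le:
  assumes nontriv: "E *v a \<noteq> 0"
    and ET: "\<And>x. E *v (T *v x) = E *v x"
    and coarse: "\<And>x. K *v (T *v x) - E *v (K *v (T *v x)) = T *v x - E *v (T *v x)"
  shows "(wonorm w (E ** (K ** T)))\<^sup>2 \<le> 1 - 1 / wonorm w compressed_inverse"
proof -
  define c where "c = wonorm w compressed_inverse"
  have c: "0 < c"
    unfolding c_def by (rule compressed_inverse_wonorm_pos [OF nontriv])
  have split: "winner w x x = winner w (E *v x) (E *v x) + winner w (x - E *v x) (x - E *v x)" for x
    using proj_sym [of x "E *v x"] proj_sym [of x x]
    by (simp add: winner_linear proj_idem winner_commute)
  have step: "winner w (E *v (K *v (T *v x))) (E *v (K *v (T *v x)))
      \<le> (1 - 1 / c) * winner w (E *v x) (E *v x)" for x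
  proof -
    define y where "y = T *v x"
    define z where "z = winner w (E *v x) (E *v x)"
    have Ey: "E *v y = E *v x"
      by (simp add: y_def ET)
    have "winner w (E *v (K *v y)) (E *v (K *v y)) = z - winner w (gap K *v y) y"
      using split [of "K *v y"] split [of y] coarse [of x]
      by (simp add: winner_gap_left Ey z_def flip: y_def)
    moreover have "z / c \<le> winner w (gap K *v y) y"
    proof (cases "z = 0")
      case True
      then show ?thesis
        by (simp add: gap_nonneg)
    next
      case False
      then have "0 < z"
        by (simp add: z_def less_le)
      then show ?thesis
        using energy_lower_bound [of y] c
        by (simp add: Ey power2_eq_square algebra_simps divide_le_eq flip: z_def c_def)
    qed
    ultimately show ?thesis
      by (simp add: y_def z_def algebra_simps)
  qed
  \<comment> \<open>Some fine part is nonzero, and there the right-hand side of \<open>step\<close> bounds a square.\<close>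
  have c1: "0 \<le> 1 - 1 / c"
    using order_trans [OF winner_self_nonneg step [of a]] winner_self_pos_iff [of "E *v a"] nontriv
    by (auto simp: zero_le_mult_iff)
  have "wonorm w (E ** (K ** T)) \<le> sqrt (1 - 1 / c)"
  proof (rule wonorm_le)
    fix x
    have "(wnorm w (E ** (K ** T) *v x))\<^sup>2 \<le> (1 - 1 / c) * (wnorm w (E *v x))\<^sup>2"
      using step [of x] by (simp add: wnorm_power2 flip: matrix_vector_mul_assoc)
    also have "\<dots> \<le> (1 - 1 / c) * (wnorm w x)\<^sup>2"
      using c1 by (intro mult_left_mono power_mono wnorm_proj_le) simp_all
    finally show "wnorm w (E ** (K ** T) *v x) \<le> sqrt (1 - 1 / c) * wnorm w x"
      by (metis real_le_rsqrt real_sqrt_mult real_sqrt_unique wnorm_nonneg)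
  qed (use c1 in simp)
  then have "(wonorm w (E ** (K ** T)))\<^sup>2 \<le> (sqrt (1 - 1 / c))\<^sup>2"
    by (intro power_mono) simp_all
  then show ?thesis
    using c1 by (simp add: c_def)
qed

lemma compressed_inverse_wonorm_le:
  assumes "\<And>z. E *v z = z \<Longrightarrow> winner w (matrix_inv (gap K) *v z) z \<le> c * winner w z z"
    and "0 \<le> c"
  shows "wonorm w compressed_inverse \<le> c"
proof (rule symmetric_wonorm_le)
  fix x
  show "0 \<le> winner w (compressed_inverse *v x) x"
    using gap_inverse_pos_def [of "E *v x"]
    by (cases "E *v x = 0") (simp_all add: winner_compressed_inverse less_imp_le)
  have "winner w (compressed_inverse *v x) x \<le> c * winner w (E *v x) (E *v x)"
    by (simp add: winner_compressed_inverse assms proj_idem)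
  also have "\<dots> \<le> c * winner w x x"
    using wnorm_proj_le [of x] \<open>0 \<le> c\<close>
    by (intro mult_left_mono) (simp_all flip: wnorm_power2 add: power_mono)
  finally show "winner w (compressed_inverse *v x) x \<le> c * winner w x x" .
next
  show "winner w (compressed_inverse *v x) y = winner w x (compressed_inverse *v y)" for x y
    by (metis winner_commute winner_compressed_inverse winner_gap_inverse_commute)
qed (fact \<open>0 \<le> c\<close>)

end
end

end

section \<open>Strict contraction of the deflated chain\<close>

text \<open>An edge into \<open>i\<close> from a state of positive mass gives \<open>i\<close> positive mass, and every state is
  reachable from one of positive mass.\<close>

lemma stationary_positive:
  fixes P :: "real^'n^'n"
  assumes "column_stochastic P" and "irreducible_matrix P"
    and nonneg: "\<And>x. 0 \<le> \<mu> $ x" and "\<mu> \<noteq> 0" and stat: "P *v \<mu> = \<mu>"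
  shows "0 < \<mu> $ x"
proof -
  have P: "0 \<le> P $ i $ j" for i j
    using assms(1) by (simp add: column_stochastic_def)
  have step: "0 < \<mu> $ i" if "P $ i $ j \<noteq> 0" and "0 < \<mu> $ j" for i j
  proof -
    have "0 < P $ i $ j * \<mu> $ j"
      using that P [of i j] by (simp add: less_le)
    also have "\<dots> \<le> (\<Sum>l\<in>UNIV. P $ i $ l * \<mu> $ l)"
      using P nonneg by (intro member_le_sum) simp_all
    also have "\<dots> = \<mu> $ i"
      by (subst stat [symmetric]) (simp add: matrix_vector_mult_def)
    finally show ?thesis .
  qed
  obtain y where y: "0 < \<mu> $ y"
    using \<open>\<mu> \<noteq> 0\<close> nonneg by (auto simp: vec_eq_iff less_le)
  have "(x, y) \<in> {(i, j). P $ i $ j \<noteq> 0}\<^sup>+"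
    using assms(2) by (simp add: irreducible_matrix_def)
  then show ?thesis
    using y by (induction rule: converse_trancl_induct) (auto intro: step)
qed

locale stationary_chain =
  fixes P :: "real^'n^'n" and \<mu> :: "real^'n"
  assumes stochastic: "column_stochastic P"
    and irreducible_gram: "irreducible_matrix (transpose P ** P)"
    and mu_pos: "0 < \<mu> $ x" and mu_sum: "(\<Sum>x\<in>UNIV. \<mu> $ x) = 1" and stationary: "P *v \<mu> = \<mu>"
begin

sublocale positive_weight "recip \<mu>"
  by unfold_locales (simp add: recip_def mu_pos)

lemma mu_neq0 [simp]: "\<mu> $ x \<noteq> 0"
  using mu_pos [of x] by simp

lemma P_nonneg: "0 \<le> P $ i $ j"
  using stochastic by (simp add: column_stochastic_def)

lemma P_column_sum: "(\<Sum>i\<in>UNIV. P $ i $ j) = 1"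
  using stochastic by (simp add: column_stochastic_def)

lemma mass_P: "(\<Sum>i\<in>UNIV. (P *v x) $ i) = (\<Sum>i\<in>UNIV. x $ i)"
proof -
  have "(\<Sum>i\<in>UNIV. (P *v x) $ i) = (\<Sum>j\<in>UNIV. \<Sum>i\<in>UNIV. P $ i $ j * x $ j)"
    unfolding matrix_vector_mult_def by (simp, rule sum.swap)
  then show ?thesis
    by (simp add: P_column_sum flip: sum_distrib_right)
qed

lemma winner_mu_right: "winner (recip \<mu>) x \<mu> = (\<Sum>i\<in>UNIV. x $ i)"
  by (simp add: winner_def recip_def)

lemma winner_mu_mu: "winner (recip \<mu>) \<mu> \<mu> = 1"
  by (simp add: winner_mu_right mu_sum)

lemma P_hat_eq: "P_hat P \<mu> *v x = P *v x - (\<Sum>i\<in>UNIV. x $ i) *\<^sub>R \<mu>"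
proof -
  have "outer \<mu> 1 *v x = (\<Sum>i\<in>UNIV. x $ i) *\<^sub>R \<mu>"
    by (simp add: outer_def matrix_vector_mult_def vec_eq_iff sum_distrib_left ac_simps)
  then show ?thesis
    by (simp add: P_hat_def matrix_vector_mult_diff_rdistrib)
qed

text \<open>The entry at \<open>(j, l)\<close> of \<open>P\<^sup>* P diag(\<mu>)\<close>: the symmetric stationary flow of the reversible chain
  that makes a step of \<open>P\<close> followed by a step of its time reversal.\<close>

definition flow :: "'n \<Rightarrow> 'n \<Rightarrow> real" where
  "flow j l = (\<Sum>i\<in>UNIV. P $ i $ j * \<mu> $ j * P $ i $ l * \<mu> $ l / \<mu> $ i)"

lemma flow_commute: "flow j l = flow l j"
  by (simp add: flow_def ac_simps)

lemma flow_nonneg: "0 \<le> flow j l"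
  unfolding flow_def using mu_pos P_nonneg by (intro sum_nonneg divide_nonneg_pos mult_nonneg_nonneg)
    (simp_all add: less_imp_le)

lemma sum_flow: "(\<Sum>l\<in>UNIV. flow j l) = \<mu> $ j"
proof -
  have "(\<Sum>l\<in>UNIV. flow j l) = (\<Sum>i\<in>UNIV. \<Sum>l\<in>UNIV. P $ i $ j * \<mu> $ j / \<mu> $ i * (P $ i $ l * \<mu> $ l))"
    unfolding flow_def by (subst sum.swap) (simp add: ac_simps)
  also have "\<dots> = (\<Sum>i\<in>UNIV. P $ i $ j * \<mu> $ j / \<mu> $ i * (P *v \<mu>) $ i)"
    by (simp add: matrix_vector_mult_def sum_distrib_left)
  also have "\<dots> = \<mu> $ j"
    by (simp add: stationary P_column_sum flip: sum_distrib_right)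
  finally show ?thesis .
qed

lemma flow_pos:
  assumes "(transpose P ** P) $ j $ l \<noteq> 0"
  shows "0 < flow j l"
proof -
  have "(transpose P ** P) $ j $ l = (\<Sum>i\<in>UNIV. P $ i $ j * P $ i $ l)"
    by (simp add: matrix_matrix_mult_def transpose_def)
  with assms obtain i where i: "P $ i $ j * P $ i $ l \<noteq> 0"
    by (metis (mono_tags, lifting) sum.not_neutral_contains_not_neutral)
  have "0 < P $ i $ j * \<mu> $ j * P $ i $ l * \<mu> $ l / \<mu> $ i"
    using i P_nonneg [of i] mu_pos by (simp add: less_le)
  also have "\<dots> \<le> flow j l"
    unfolding flow_def using P_nonneg mu_pos
    by (intro member_le_sum) (simp_all add: less_imp_le)
  finally show ?thesis .
qed

text \<open>For \<open>x = f \<mu>\<close>, the squared length of \<open>x\<close> is the flow-weighted mean of \<open>f\<^sub>j\<^sup>2\<close>, by either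
  marginal of the flow, while that of \<open>P x\<close> is the mean of \<open>f\<^sub>j f\<^sub>l\<close>; completing the square gives the formula.\<close>

lemma dirichlet_form:
  "winner (recip \<mu>) x x - winner (recip \<mu>) (P *v x) (P *v x)
    = (\<Sum>j\<in>UNIV. \<Sum>l\<in>UNIV. flow j l * (x $ j / \<mu> $ j - x $ l / \<mu> $ l)\<^sup>2) / 2"
proof -
  define f where "f j = x $ j / \<mu> $ j" for j
  have x: "x $ j = f j * \<mu> $ j" for j
    by (simp add: f_def)
  have diag: "(\<Sum>j\<in>UNIV. \<Sum>l\<in>UNIV. flow j l * (f j)\<^sup>2) = winner (recip \<mu>) x x"
    by (simp only: sum_flow flip: sum_distrib_right)
      (simp add: winner_def recip_def x power2_eq_square ac_simps)
  have diag': "(\<Sum>j\<in>UNIV. \<Sum>l\<in>UNIV. flow j l * (f l)\<^sup>2) = winner (recip \<mu>) x x"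
    by (subst sum.swap, subst flow_commute) (rule diag)
  have "winner (recip \<mu>) (P *v x) (P *v x)
    = (\<Sum>i\<in>UNIV. \<Sum>j\<in>UNIV. \<Sum>l\<in>UNIV. P $ i $ j * \<mu> $ j * P $ i $ l * \<mu> $ l / \<mu> $ i * (f j * f l))"
    by (simp add: winner_def recip_def matrix_vector_mult_def x sum_product sum_divide_distrib ac_simps)
  also have "\<dots> = (\<Sum>j\<in>UNIV. \<Sum>i\<in>UNIV. \<Sum>l\<in>UNIV. P $ i $ j * \<mu> $ j * P $ i $ l * \<mu> $ l / \<mu> $ i * (f j * f l))"
    by (rule sum.swap)
  also have "\<dots> = (\<Sum>j\<in>UNIV. \<Sum>l\<in>UNIV. \<Sum>i\<in>UNIV. P $ i $ j * \<mu> $ j * P $ i $ l * \<mu> $ l / \<mu> $ i * (f j * f l))"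
    by (intro sum.cong refl sum.swap)
  also have "\<dots> = (\<Sum>j\<in>UNIV. \<Sum>l\<in>UNIV. flow j l * (f j * f l))"
    by (simp add: flow_def sum_distrib_right)
  finally have cross: "(\<Sum>j\<in>UNIV. \<Sum>l\<in>UNIV. flow j l * (f j * f l))
    = winner (recip \<mu>) (P *v x) (P *v x)" ..
  have "(\<Sum>j\<in>UNIV. \<Sum>l\<in>UNIV. flow j l * (f j - f l)\<^sup>2)
    = (\<Sum>j\<in>UNIV. \<Sum>l\<in>UNIV. flow j l * (f j)\<^sup>2 + flow j l * (f l)\<^sup>2 - 2 * (flow j l * (f j * f l)))"
    by (simp add: power2_eq_square algebra_simps)
  also have "\<dots> = 2 * winner (recip \<mu>) x x - 2 * winner (recip \<mu>) (P *v x) (P *v x)"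
    by (simp add: sum.distrib sum_subtractf diag diag' cross flip: sum_distrib_left)
  finally show ?thesis
    by (simp add: f_def)
qed

lemma P_contracting: "winner (recip \<mu>) (P *v x) (P *v x) \<le> winner (recip \<mu>) x x"
proof -
  have "0 \<le> (\<Sum>j\<in>UNIV. \<Sum>l\<in>UNIV. flow j l * (x $ j / \<mu> $ j - x $ l / \<mu> $ l)\<^sup>2) / 2"
    using flow_nonneg by (intro divide_nonneg_nonneg sum_nonneg mult_nonneg_nonneg) simp_all
  then show ?thesis
    using dirichlet_form [of x] by linarith
qed

text \<open>Equality forces \<open>x / \<mu>\<close> to agree along every edge of \<open>P\<^sup>t P\<close>, hence to be constant; the sum
  of the entries identifies the constant.\<close>

lemma P_isometric_imp_mu_multiple:
  assumes "winner (recip \<mu>) (P *v x) (P *v x) = winner (recip \<mu>) x x"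
  shows "x = (\<Sum>i\<in>UNIV. x $ i) *\<^sub>R \<mu>"
proof -
  have terms: "0 \<le> flow j l * (x $ j / \<mu> $ j - x $ l / \<mu> $ l)\<^sup>2" for j l
    using flow_nonneg by simp
  have "(\<Sum>j\<in>UNIV. \<Sum>l\<in>UNIV. flow j l * (x $ j / \<mu> $ j - x $ l / \<mu> $ l)\<^sup>2) = 0"
    using dirichlet_form [of x] assms by simp
  then have zero: "flow j l * (x $ j / \<mu> $ j - x $ l / \<mu> $ l)\<^sup>2 = 0" for j l
    using terms by (simp add: sum_nonneg_eq_0_iff sum_nonneg)
  have edge: "x $ j / \<mu> $ j = x $ l / \<mu> $ l" if "(transpose P ** P) $ j $ l \<noteq> 0" for j l
    using zero [of j l] flow_pos [OF that] by simp
  have const: "x $ j / \<mu> $ j = x $ l / \<mu> $ l" for j l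
  proof -
    have "(j, l) \<in> {(i, j). (transpose P ** P) $ i $ j \<noteq> 0}\<^sup>+"
      using irreducible_gram by (simp add: irreducible_matrix_def)
    then show ?thesis
    proof (induction rule: trancl_induct)
      case (base y)
      then show ?case by (simp add: edge)
    next
      case (step y z)
      then show ?case using edge [of y z] by simp
    qed
  qed
  define c where "c = x $ undefined / \<mu> $ undefined"
  have "x $ j = c * \<mu> $ j" for j
    using const [of j undefined] by (simp add: c_def field_simps)
  moreover from this have "(\<Sum>i\<in>UNIV. x $ i) = c"
    by (simp add: mu_sum flip: sum_distrib_left)
  ultimately show ?thesis
    by (simp add: vec_eq_iff)
qed

text \<open>With \<open>y\<close> the part of \<open>x\<close> orthogonal to \<open>\<mu>\<close>, the image is \<open>P y\<close>.  It has the length of \<open>y\<close> only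
  when \<open>y = 0\<close>.\<close>

lemma P_hat_strict_contraction:
  assumes "x \<noteq> 0"
  shows "wnorm (recip \<mu>) (P_hat P \<mu> *v x) < wnorm (recip \<mu>) x"
proof -
  define m where "m = (\<Sum>i\<in>UNIV. x $ i)"
  define y where "y = x - m *\<^sub>R \<mu>"
  have Py: "P_hat P \<mu> *v x = P *v y"
    by (simp add: P_hat_eq m_def y_def matrix_vector_mult_diff_distrib matrix_vector_mult_scaleR
        stationary)
  have ymu: "winner (recip \<mu>) y \<mu> = 0"
    by (simp add: y_def winner_linear winner_mu_mu) (simp add: winner_mu_right m_def)
  have xy: "winner (recip \<mu>) x x = winner (recip \<mu>) y y + m\<^sup>2"
    using ymu winner_commute [of "recip \<mu>" \<mu> y]
    by (simp add: y_def winner_linear winner_mu_mu power2_eq_square winner_commute [of _ \<mu> x])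
  have "winner (recip \<mu>) (P *v y) (P *v y) < winner (recip \<mu>) x x"
  proof (cases "winner (recip \<mu>) (P *v y) (P *v y) = winner (recip \<mu>) y y")
    case True
    then have "y = 0"
      using P_isometric_imp_mu_multiple [of y] ymu by (simp add: winner_mu_right)
    then show ?thesis
      using assms by (simp add: winner_self_pos_iff)
  next
    case False
    then show ?thesis
      using P_contracting [of y] xy zero_le_power2 [of m] by linarith
  qed
  then show ?thesis
    by (simp add: Py wnorm_def)
qed

end

section \<open>Aggregation and the coarse correction\<close>

lemma aggr_disaggr:
  fixes S :: "'m::finite \<Rightarrow> 'n::finite set"
  assumes "coarse_states S" and pos: "\<And>x. 0 < \<mu> $ x"
  shows "aggr S ** disaggr S \<mu> = mat 1"
proof -
  have "(aggr S *v (disaggr S \<mu> *v z)) $ i = z $ i" for z i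
  proof -
    have "(aggr S *v (disaggr S \<mu> *v z)) $ i = (\<Sum>x\<in>S i. z $ i * \<mu> $ x / (aggr S *v \<mu>) $ i)"
      unfolding aggr_mult [of S "disaggr S \<mu> *v z"]
      by (intro sum.cong refl disaggr_mult assms(1))
    also have "\<dots> = z $ i * (\<Sum>x\<in>S i. \<mu> $ x) / (aggr S *v \<mu>) $ i"
      by (simp add: sum_distrib_left sum_divide_distrib)
    also have "\<dots> = z $ i"
    proof -
      have "S i \<noteq> {}"
        using assms(1) by (simp add: coarse_states_def)
      then have "0 < (\<Sum>x\<in>S i. \<mu> $ x)"
        using pos by (intro sum_pos) simp_all
      then show ?thesis
        by (simp add: aggr_mult)
    qed
    finally show ?thesis .
  qed
  then show ?thesis
    unfolding matrix_eq matrix_vector_mul_assoc [symmetric] by (simp add: vec_eq_iff)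
qed

lemma Pi_mat_mult:
  assumes "coarse_states S" and "j \<in> S i"
  shows "(Pi_mat S \<mu> *v x) $ j = (\<Sum>l\<in>S i. x $ l) * \<mu> $ j / (\<Sum>l\<in>S i. \<mu> $ l)"
  unfolding Pi_mat_def matrix_vector_mul_assoc [symmetric] disaggr_mult [OF assms] aggr_mult ..

locale coarse_chain = stationary_chain +
  fixes S :: "'m::finite \<Rightarrow> 'a set"
  assumes coarse: "coarse_states S"
begin

abbreviation "E \<equiv> mat 1 - Pi_mat S \<mu>"
abbreviation "K \<equiv> P_hat P \<mu>"

lemma E_mult: "E *v x = x - Pi_mat S \<mu> *v x"
  by (simp add: matrix_vector_mult_diff_rdistrib)

lemma aggr_of_disaggr: "aggr S *v (disaggr S \<mu> *v z) = z"
  using aggr_disaggr [OF coarse mu_pos] by (simp add: matrix_vector_mul_assoc)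

lemma Pi_mult: "Pi_mat S \<mu> *v x = disaggr S \<mu> *v (aggr S *v x)"
  by (simp add: Pi_mat_def matrix_vector_mul_assoc)

lemma winner_disaggr:
  "winner (recip \<mu>) (disaggr S \<mu> *v z) y
    = (\<Sum>i\<in>UNIV. z $ i * (aggr S *v y) $ i / (aggr S *v \<mu>) $ i)"
proof -
  define m where "m = aggr S *v \<mu>"
  have "winner (recip \<mu>) (disaggr S \<mu> *v z) y
    = (\<Sum>j\<in>UNIV. \<Sum>i\<in>UNIV. z $ i / m $ i * (aggr S $ i $ j * y $ j))"
    unfolding winner_def
    by (simp add: disaggr_def matrix_vector_mult_def [of "\<chi> j i. _ j i"] recip_def aggr_def
        sum_distrib_right sum_divide_distrib) (intro sum.cong refl, simp add: m_def)
  also have "\<dots> = (\<Sum>i\<in>UNIV. \<Sum>j\<in>UNIV. z $ i / m $ i * (aggr S $ i $ j * y $ j))"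
    by (rule sum.swap)
  also have "\<dots> = (\<Sum>i\<in>UNIV. z $ i * (aggr S *v y) $ i / m $ i)"
    by (simp add: matrix_vector_mult_def sum_distrib_left sum_divide_distrib)
  finally show ?thesis
    by (simp add: m_def)
qed

text \<open>The form \<open>\<langle>\<Pi> x, y\<rangle>\<close> is the inner product of \<open>A x\<close> and \<open>A y\<close> with the reciprocal coarse masses as
  weight, hence symmetric.\<close>

lemma E_sym: "winner (recip \<mu>) (E *v x) y = winner (recip \<mu>) x (E *v y)"
  using winner_commute [of "recip \<mu>" x "Pi_mat S \<mu> *v y"]
  by (simp add: E_mult winner_linear Pi_mult winner_disaggr ac_simps)

lemma E_idem: "E *v (E *v x) = E *v x"
  by (simp add: E_mult Pi_mult aggr_of_disaggr matrix_vector_mult_diff_distrib)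

lemma Pi_mu: "Pi_mat S \<mu> *v \<mu> = \<mu>"
proof -
  have "(Pi_mat S \<mu> *v \<mu>) $ j = \<mu> $ j" for j
  proof -
    obtain i where i: "j \<in> S i"
      using coarse unfolding coarse_states_def by blast
    have "0 < (\<Sum>l\<in>S i. \<mu> $ l)"
      using i mu_pos by (intro sum_pos) auto
    then show ?thesis
      by (simp add: Pi_mat_mult [OF coarse i])
  qed
  then show ?thesis
    by (simp add: vec_eq_iff)
qed

text \<open>A unit vector at one of two fine states in the same coarse state is spread over both.\<close>

lemma E_nontrivial:
  assumes "1 < card (S i)"
  obtains a where "E *v a \<noteq> 0"
proof -
  obtain x y where xy: "x \<in> S i" "y \<in> S i" "x \<noteq> y"
    using assms by (metis card_le_Suc0_iff_eq finite not_less One_nat_def)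
  have m: "0 < (\<Sum>l\<in>S i. \<mu> $ l)"
    using xy(1) mu_pos by (intro sum_pos) auto
  have "(\<Sum>l\<in>S i. axis x 1 $ l) = (1::real)"
    using xy(1) by (simp add: axis_def)
  then have "(E *v axis x 1) $ y \<noteq> 0"
    using xy m by (simp add: E_mult Pi_mat_mult [OF coarse xy(2)]) (simp add: axis_def)
  then show ?thesis
    by (metis that zero_index)
qed

abbreviation "L \<equiv> mat 1 - P + outer \<mu> 1"

lemma L_mult: "L *v x = x - K *v x"
  by (simp add: P_hat_def algebra_simps matrix_vector_mult_diff_rdistrib matrix_vector_mult_add_rdistrib)

text \<open>On coarse vectors \<open>y = D z\<close> the form of the coarse operator is \<open>\<langle>y - K y, y\<rangle>\<close>, which is positive
  because \<open>K\<close> is a strict contraction.\<close>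

lemma invertible_coarse_operator: "invertible (aggr S ** L ** disaggr S \<mu>)"
proof -
  have "z = 0" if "(aggr S ** L ** disaggr S \<mu>) *v z = 0" for z
  proof (rule ccontr)
    assume "z \<noteq> 0"
    define y where "y = disaggr S \<mu> *v z"
    have "y \<noteq> 0"
      using \<open>z \<noteq> 0\<close> aggr_of_disaggr [of z] by (auto simp: y_def)
    have "Pi_mat S \<mu> *v (L *v y) = 0"
      using that by (simp add: y_def Pi_mult flip: matrix_vector_mul_assoc)
    moreover have "E *v y = 0"
      by (simp add: y_def E_mult Pi_mult aggr_of_disaggr)
    ultimately have "winner (recip \<mu>) (L *v y) y = 0"
      using E_sym [of "L *v y" y] by (simp add: E_mult)
    then have "winner (recip \<mu>) y y = winner (recip \<mu>) (K *v y) y"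
      by (simp add: L_mult winner_linear)
    also have "\<dots> \<le> wnorm (recip \<mu>) (K *v y) * wnorm (recip \<mu>) y"
      by (rule Cauchy_Schwarz_winner)
    also have "\<dots> < wnorm (recip \<mu>) y * wnorm (recip \<mu>) y"
      using \<open>y \<noteq> 0\<close> by (intro mult_strict_right_mono P_hat_strict_contraction)
        (simp_all add: wnorm_pos_iff)
    finally show False
      by (simp add: power2_eq_square flip: wnorm_power2)
  qed
  then show ?thesis
    by (simp add: invertible_left_inverse matrix_left_invertible_ker)
qed

abbreviation "T \<equiv> mat 1 - S_mat S P \<mu>"

lemma S_mat_mult:
  "S_mat S P \<mu> *v x = disaggr S \<mu> *v
    (matrix_inv (aggr S ** L ** disaggr S \<mu>) *v (aggr S *v (L *v x)))"
  by (simp only: S_mat_def flip: matrix_vector_mul_assoc)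

lemma T_mult: "T *v x = x - S_mat S P \<mu> *v x"
  by (simp add: matrix_vector_mult_diff_rdistrib)

lemma aggr_L_S_mat: "aggr S *v (L *v (S_mat S P \<mu> *v x)) = aggr S *v (L *v x)"
proof -
  have "aggr S *v (L *v (S_mat S P \<mu> *v x)) = (aggr S ** L ** disaggr S \<mu>) *v
    (matrix_inv (aggr S ** L ** disaggr S \<mu>) *v (aggr S *v (L *v x)))"
    by (simp only: S_mat_mult flip: matrix_vector_mul_assoc)
  then show ?thesis
    by (metis matrix_inv_right [OF invertible_coarse_operator] matrix_vector_mul_assoc
        matrix_vector_mul_lid)
qed

lemma T_Pi: "T *v (Pi_mat S \<mu> *v x) = 0"
proof -
  have "S_mat S P \<mu> *v (disaggr S \<mu> *v z) = disaggr S \<mu> *v z" for z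
    unfolding S_mat_mult
    by (metis matrix_inv_left [OF invertible_coarse_operator] matrix_vector_mul_assoc
        matrix_vector_mul_lid)
  then show ?thesis
    by (simp add: T_mult Pi_mult)
qed

lemma E_T: "E *v (T *v x) = E *v x"
proof -
  have "Pi_mat S \<mu> *v (S_mat S P \<mu> *v x) = S_mat S P \<mu> *v x"
    by (simp add: S_mat_mult Pi_mult aggr_of_disaggr)
  then show ?thesis
    by (simp add: E_mult T_mult matrix_vector_mult_diff_distrib)
qed

text \<open>Both sides are the coarse part of a vector; they agree since \<open>A (I - K) T = 0\<close>, which is what
  the inverse in \<open>S(\<mu>)\<close> achieves.\<close>

lemma Pi_K_T: "K *v (T *v x) - E *v (K *v (T *v x)) = T *v x - E *v (T *v x)"
proof -
  have "aggr S *v (L *v (T *v x)) = 0"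
    by (simp add: T_mult matrix_vector_mult_diff_distrib [of L]
        matrix_vector_mult_diff_distrib [of "aggr S"] aggr_L_S_mat)
  then have "aggr S *v (T *v x) = aggr S *v (K *v (T *v x))"
    by (simp add: L_mult matrix_vector_mult_diff_distrib [of "aggr S"])
  then show ?thesis
    by (simp add: E_mult Pi_mult)
qed

lemma J_mat_E: "J_mat S P \<mu> ** E = J_mat S P \<mu>"
proof -
  have "T *v (E *v x) = T *v x" for x
    by (simp only: E_mult matrix_vector_mult_diff_distrib T_Pi) simp
  then show ?thesis
    by (simp only: matrix_eq J_mat_def flip: matrix_vector_mul_assoc) simp
qed

text \<open>Besides ensuring that the spectral radius is the maximum of a nonempty set, this reflects
  that \<open>\<mu>\<close> is itself a coarse vector.\<close>

lemma zero_in_spectrum_J: "0 \<in> spectrum (J_mat S P \<mu>)"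
proof -
  have "T *v \<mu> = 0"
    using T_Pi [of \<mu>] by (simp only: Pi_mu)
  then have "J_mat S P \<mu> *v \<mu> = 0 *\<^sub>R \<mu>"
    by (simp add: J_mat_def flip: matrix_vector_mul_assoc)
  moreover have "\<mu> \<noteq> 0"
    using mu_neq0 by (metis zero_index)
  ultimately show ?thesis
    using real_eigenvalue_in_spectrum by fastforce
qed

theorem spectral_radius_J_le:
  "(spectral_radius (J_mat S P \<mu>))\<^sup>2 \<le> (wonorm (recip \<mu>) (E ** J_mat S P \<mu>))\<^sup>2"
  using zero_in_spectrum_J
  by (intro power_mono spectral_radius_le_wonorm_mult spectral_radius_nonneg J_mat_E) auto

theorem wonorm_J_le:
  assumes "E *v a \<noteq> 0"
  shows "(wonorm (recip \<mu>) (E ** J_mat S P \<mu>))\<^sup>2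
    \<le> 1 - 1 / wonorm (recip \<mu>) (E ** matrix_inv (gap K) ** E)"
  unfolding J_mat_def
  by (rule wonorm_coarse_corrected_le [OF P_hat_strict_contraction E_sym E_idem assms E_T Pi_K_T])

end

section \<open>Spectral bound for the compressed inverse\<close>

lemma outer_mult: "outer x y *v z = (\<Sum>j\<in>UNIV. y $ j * z $ j) *\<^sub>R x"
  by (simp add: outer_def matrix_vector_mult_def vec_eq_iff sum_distrib_left ac_simps)

locale chain_eigenbasis = stationary_chain +
  fixes lam :: "nat \<Rightarrow> real" and v :: "nat \<Rightarrow> real^'a"
  assumes eigenbasis: "ordered_eigenbasis (recip \<mu>) (wadjoint (recip \<mu>) P ** P) lam v"
    and v1: "v 1 = \<mu>"
begin

lemma orthonormal:
  "\<forall>i\<in>{1..CARD('a)}. \<forall>j\<in>{1..CARD('a)}. winner (recip \<mu>) (v i) (v j) = (if i = j then 1 else 0)"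
  using eigenbasis by (simp add: ordered_eigenbasis_def)

lemma lam_antimono: "1 \<le> i \<Longrightarrow> i \<le> j \<Longrightarrow> j \<le> CARD('a) \<Longrightarrow> lam j \<le> lam i"
  using eigenbasis by (simp add: ordered_eigenbasis_def)

text \<open>The eigenvectors after the first are orthogonal to \<open>\<mu>\<close>, that is, their entries sum to zero, so
  that \<open>P_hat P \<mu>\<close> and \<open>P\<close> agree on them.\<close>

lemma winner_gap_eigenvector:
  assumes "2 \<le> i" and "i \<le> CARD('a)"
  shows "winner (recip \<mu>) u (gap (P_hat P \<mu>) *v v i) = (1 - lam i) * winner (recip \<mu>) u (v i)"
proof -
  have mass: "(\<Sum>j\<in>UNIV. v i $ j) = 0"
    using orthonormal assms v1 winner_mu_right [of "v i"] by force
  have "(wadjoint (recip \<mu>) P ** P) *v v i = lam i *\<^sub>R v i"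
    using eigenbasis assms by (simp add: ordered_eigenbasis_def)
  then have "winner (recip \<mu>) (P *v u) (P *v v i) = lam i * winner (recip \<mu>) u (v i)"
    by (simp add: winner_wadjoint matrix_vector_mul_assoc winner_scaleR_right)
  moreover have "winner (recip \<mu>) \<mu> (P *v v i) = 0"
    using winner_mu_right [of "P *v v i"] by (simp add: winner_commute mass_P mass)
  ultimately show ?thesis
    by (simp add: winner_gap_right P_hat_eq mass winner_linear algebra_simps)
qed

lemma lam_less_1:
  assumes "2 \<le> i" and "i \<le> CARD('a)"
  shows "lam i < 1"
proof -
  have unit: "winner (recip \<mu>) (v i) (v i) = 1"
    using orthonormal assms by simp
  then have "v i \<noteq> 0"
    by auto
  from gap_pos_def [OF P_hat_strict_contraction this] show ?thesis
    using winner_gap_eigenvector [OF assms, of "v i"] by (simp add: winner_commute unit)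
qed

lemma Q_mult:
  assumes "1 \<le> k"
  shows "Q_mat \<mu> v k *v z = (\<Sum>i=1..k. winner (recip \<mu>) z (v i) *\<^sub>R v i)"
proof -
  have diag: "(diag (recip \<mu>) *v x) $ j = x $ j / \<mu> $ j" for x j
    by (simp add: diag_def recip_def matrix_vector_mult_def if_distrib if_distribR cong: if_cong)
  have v_term: "outer (v i) (diag (recip \<mu>) *v v i) *v z = winner (recip \<mu>) z (v i) *\<^sub>R v i" for i
    by (simp only: outer_mult diag) (simp add: winner_def recip_def ac_simps)
  have sum_mult: "(\<Sum>i\<in>I. M i) *v z = (\<Sum>i\<in>I. M i *v z)"
    for I :: "nat set" and M :: "nat \<Rightarrow> real^'a^'a"
    by (induction I rule: infinite_finite_induct) (simp_all add: matrix_vector_mult_add_rdistrib)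
  have first: "outer \<mu> 1 *v z = winner (recip \<mu>) z (v 1) *\<^sub>R v 1"
    unfolding v1 by (simp add: outer_mult winner_mu_right)
  have "Q_mat \<mu> v k *v z
    = winner (recip \<mu>) z (v 1) *\<^sub>R v 1 + (\<Sum>i=2..k. winner (recip \<mu>) z (v i) *\<^sub>R v i)"
    by (simp only: Q_mat_def matrix_vector_mult_add_rdistrib sum_mult v_term first)
  also have "\<dots> = (\<Sum>i=1..k. winner (recip \<mu>) z (v i) *\<^sub>R v i)"
    using assms by (simp add: sum.atLeast_Suc_atMost numeral_2_eq_2)
  finally show ?thesis .
qed

text \<open>\<open>Q\<close> is the orthogonal projection onto the span of \<open>v\<^sub>1, \<dots>, v\<^sub>k\<close>.\<close>

lemma wnorm_Q_power2:
  assumes "1 \<le> k" and "k \<le> CARD('a)"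
  shows "(wnorm (recip \<mu>) (Q_mat \<mu> v k *v z))\<^sup>2 = (\<Sum>i=1..k. (winner (recip \<mu>) z (v i))\<^sup>2)"
proof -
  define a where "a i = winner (recip \<mu>) z (v i)" for i
  have expand: "winner (recip \<mu>) (Q_mat \<mu> v k *v z) y
      = (\<Sum>j=1..k. a j * winner (recip \<mu>) (v j) y)" for y
    by (simp add: Q_mult [OF assms(1)] winner_sum_left winner_scaleR_left a_def)
  have Qv: "winner (recip \<mu>) (v i) (Q_mat \<mu> v k *v z) = a i" if i: "i \<in> {1..k}" for i
  proof -
    have "winner (recip \<mu>) (v i) (Q_mat \<mu> v k *v z)
        = (\<Sum>j=1..k. a j * winner (recip \<mu>) (v j) (v i))"
      using expand [of "v i"] by (simp add: winner_commute)
    also have "\<dots> = (\<Sum>j=1..k. if j = i then a j else 0)"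
      using orthonormal i assms(2) by (intro sum.cong) auto
    finally show ?thesis
      using i by simp
  qed
  have "(wnorm (recip \<mu>) (Q_mat \<mu> v k *v z))\<^sup>2
    = (\<Sum>i=1..k. a i * winner (recip \<mu>) (v i) (Q_mat \<mu> v k *v z))"
    unfolding wnorm_power2 by (rule expand)
  also have "\<dots> = (\<Sum>i=1..k. (a i)\<^sup>2)"
    by (rule sum.cong) (simp_all only: Qv power2_eq_square)
  finally show ?thesis
    by (simp add: a_def)
qed

text \<open>Off \<open>\<mu>\<close> the inverse has the eigenvalues \<open>1 / (1 - \<lambda>\<^sub>i)\<close>, which decrease with \<open>i\<close>: at most
  \<open>1 / (1 - \<lambda>\<^sub>2)\<close> on the range of \<open>Q\<close> and at most \<open>1 / (1 - \<lambda>\<^sub>k\<^sub>+\<^sub>1)\<close> on its complement.\<close>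

lemma gap_inverse_form_le:
  assumes k: "1 \<le> k" "k < CARD('a)" and z: "winner (recip \<mu>) z \<mu> = 0"
  defines "q \<equiv> (wnorm (recip \<mu>) (Q_mat \<mu> v k *v z))\<^sup>2"
  shows "winner (recip \<mu>) (matrix_inv (gap (P_hat P \<mu>)) *v z) z
    \<le> q / (1 - lam 2) + (winner (recip \<mu>) z z - q) / (1 - lam (k + 1))"
proof -
  define u where "u = matrix_inv (gap (P_hat P \<mu>)) *v z"
  define a b where "a i = winner (recip \<mu>) z (v i)" and "b i = winner (recip \<mu>) u (v i)" for i
  have gap_u: "gap (P_hat P \<mu>) *v u = z"
    unfolding u_def by (rule gap_inverse [OF P_hat_strict_contraction])
  have ab: "a i = (1 - lam i) * b i" if "2 \<le> i" "i \<le> CARD('a)" for i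
    unfolding a_def b_def winner_gap_eigenvector [OF that, symmetric] gap_u [symmetric]
    by (simp add: winner_gap_left winner_gap_right)
  \<comment> \<open>The case \<open>i = 1\<close> is covered because the coefficient of \<open>\<mu>\<close> vanishes.\<close>
  have term_le: "b i * a i \<le> (a i)\<^sup>2 / (1 - lam j)"
    if "2 \<le> j" "j \<le> i \<or> i = 1" "i \<le> CARD('a)" "j \<le> CARD('a)" for i j
  proof (cases "i = 1")
    case True
    then show ?thesis
      using z by (simp add: a_def v1 [unfolded One_nat_def])
  next
    case False
    then have "2 \<le> i" "lam i < 1" "lam j < 1" "lam i \<le> lam j"
      using that lam_less_1 lam_antimono [of j i] by auto
    moreover have "b i * a i = (a i)\<^sup>2 / (1 - lam i)"
      using ab [of i] that \<open>2 \<le> i\<close> \<open>lam i < 1\<close> by (simp add: power2_eq_square)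
    ultimately show ?thesis
      by (simp add: divide_left_mono)
  qed
  have split: "(\<Sum>i=1..CARD('a). f i) = (\<Sum>i=1..k. f i) + (\<Sum>i=k+1..CARD('a). f i)"
    for f :: "nat \<Rightarrow> real"
    using sum.ub_add_nat [of 1 k f "CARD('a) - k"] k by simp
  have q: "q = (\<Sum>i=1..k. (a i)\<^sup>2)"
    using k by (simp add: q_def wnorm_Q_power2 a_def)
  have rest: "winner (recip \<mu>) z z - q = (\<Sum>i=k+1..CARD('a). (a i)\<^sup>2)"
    using orthonormal_expansion [OF orthonormal, of z z]
    by (simp only: split q power2_eq_square a_def)
  have "winner (recip \<mu>) u z = (\<Sum>i=1..k. b i * a i) + (\<Sum>i=k+1..CARD('a). b i * a i)"
    using orthonormal_expansion [OF orthonormal, of u z]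
    by (simp only: split a_def b_def)
  also have "\<dots> \<le> (\<Sum>i=1..k. (a i)\<^sup>2 / (1 - lam 2))
      + (\<Sum>i=k+1..CARD('a). (a i)\<^sup>2 / (1 - lam (k + 1)))"
    using k by (intro add_mono sum_mono term_le) auto
  also have "\<dots> = q / (1 - lam 2) + (winner (recip \<mu>) z z - q) / (1 - lam (k + 1))"
    by (simp only: flip: q rest sum_divide_distrib)
  finally show ?thesis
    by (simp only: u_def)
qed

end

locale coarse_chain_eigenbasis = coarse_chain + chain_eigenbasis
begin

text \<open>The bound \<open>q / (1 - \<lambda>\<^sub>2) + (\<parallel>z\<parallel>\<^sup>2 - q) / (1 - \<lambda>\<^sub>k\<^sub>+\<^sub>1)\<close> grows with \<open>q = \<parallel>Q z\<parallel>\<^sup>2\<close>, so the angle enters as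
  an upper bound for \<open>q\<close>.\<close>

lemma wonorm_compressed_inverse_le_angle:
  assumes k: "1 \<le> k" "k < CARD('a)"
    and sin: "sin \<theta> = wonorm \<mu> ((mat 1 - transpose (Pi_mat S \<mu>)) ** transpose (Q_mat \<mu> v k))"
  shows "wonorm (recip \<mu>) (E ** matrix_inv (gap K) ** E)
    \<le> (sin \<theta>)\<^sup>2 * (1 / (1 - lam 2)) + (cos \<theta>)\<^sup>2 * (1 / (1 - lam (k + 1)))"
proof -
  interpret mu: positive_weight \<mu>
    by unfold_locales (rule mu_pos)
  define \<alpha> \<beta> where "\<alpha> = 1 / (1 - lam 2)" and "\<beta> = 1 / (1 - lam (k + 1))"
  have lam: "lam 2 < 1" "lam (k + 1) < 1" "lam (k + 1) \<le> lam 2"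
    using k by (auto intro!: lam_less_1 lam_antimono)
  then have \<beta>: "0 < \<beta>" "\<beta> \<le> \<alpha>"
    by (simp_all add: \<alpha>_def \<beta>_def frac_le)
  have "transpose (mat 1 - Pi_mat S \<mu>) = mat 1 - transpose (Pi_mat S \<mu>)"
    by (simp add: transpose_def mat_def vec_eq_iff)
  then have angle: "sin \<theta> = wonorm \<mu> (transpose (Q_mat \<mu> v k ** E))"
    by (simp add: sin matrix_transpose_mul)
  have cos: "(cos \<theta>)\<^sup>2 = 1 - (sin \<theta>)\<^sup>2"
    by (simp add: cos_squared_eq)
  have "winner (recip \<mu>) (matrix_inv (gap K) *v z) z
      \<le> ((sin \<theta>)\<^sup>2 * \<alpha> + (cos \<theta>)\<^sup>2 * \<beta>) * winner (recip \<mu>) z z" if z: "E *v z = z" for z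
  proof -
    have "E *v \<mu> = 0"
      by (simp add: E_mult Pi_mu)
    then have zmu: "winner (recip \<mu>) z \<mu> = 0"
      using E_sym [of z \<mu>] z by simp
    define q where "q = (wnorm (recip \<mu>) (Q_mat \<mu> v k *v z))\<^sup>2"
    have "wnorm (recip \<mu>) (Q_mat \<mu> v k *v z) \<le> sin \<theta> * wnorm (recip \<mu>) z"
      using mu.wnorm_recip_mult_le [of "Q_mat \<mu> v k ** E" z] z
      by (simp only: angle flip: matrix_vector_mul_assoc)
    then have "q \<le> (sin \<theta> * wnorm (recip \<mu>) z)\<^sup>2"
      unfolding q_def by (rule power_mono) simp
    then have q: "q \<le> (sin \<theta>)\<^sup>2 * winner (recip \<mu>) z z"
      by (simp add: power_mult_distrib wnorm_power2)
    have "winner (recip \<mu>) (matrix_inv (gap K) *v z) z \<le> q * \<alpha> + (winner (recip \<mu>) z z - q) * \<beta>"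
      using gap_inverse_form_le [OF k zmu] by (simp add: q_def \<alpha>_def \<beta>_def)
    also have "\<dots> = q * (\<alpha> - \<beta>) + winner (recip \<mu>) z z * \<beta>"
      by (simp add: algebra_simps)
    also have "\<dots> \<le> (sin \<theta>)\<^sup>2 * winner (recip \<mu>) z z * (\<alpha> - \<beta>) + winner (recip \<mu>) z z * \<beta>"
      using q \<beta> by (intro add_right_mono mult_right_mono) simp_all
    also have "\<dots> = ((sin \<theta>)\<^sup>2 * \<alpha> + (cos \<theta>)\<^sup>2 * \<beta>) * winner (recip \<mu>) z z"
      by (simp add: cos algebra_simps)
    finally show ?thesis .
  qed
  moreover have "0 \<le> (sin \<theta>)\<^sup>2 * \<alpha> + (cos \<theta>)\<^sup>2 * \<beta>"
    using \<beta> by simp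
  ultimately show ?thesis
    unfolding \<alpha>_def [symmetric] \<beta>_def [symmetric]
    by (intro compressed_inverse_wonorm_le [OF P_hat_strict_contraction E_sym E_idem])
qed

end

theorem theorem3:
  fixes P :: "real^'n^'n" and \<mu> :: "real^'n" and S :: "'m::finite \<Rightarrow> 'n set"
    and lam :: "nat \<Rightarrow> real" and v :: "nat \<Rightarrow> real^'n" and k :: nat and \<theta> :: real
  assumes "column_stochastic P"
    and "irreducible_matrix P"
    and "irreducible_matrix (transpose P ** P)"
    and "\<And>x. 0 \<le> \<mu> $ x" and "(\<Sum>x\<in>UNIV. \<mu> $ x) = 1" and "P *v \<mu> = \<mu>"
    and "coarse_states S"
    and "\<exists>i. card (S i) > 1"
    and "ordered_eigenbasis (recip \<mu>) (wadjoint (recip \<mu>) P ** P) lam v" and "v 1 = \<mu>"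
    and "1 \<le> k" and "k < CARD('n)"
    and "0 \<le> \<theta>" and "\<theta> \<le> pi / 2"
    and "sin \<theta> = wonorm \<mu> ((mat 1 - transpose (Pi_mat S \<mu>)) ** transpose (Q_mat \<mu> v k))"
  shows "(spectral_radius (J_mat S P \<mu>))\<^sup>2
           \<le> (wonorm (recip \<mu>) ((mat 1 - Pi_mat S \<mu>) ** J_mat S P \<mu>))\<^sup>2
       \<and> (wonorm (recip \<mu>) ((mat 1 - Pi_mat S \<mu>) ** J_mat S P \<mu>))\<^sup>2
           \<le> 1 - 1 / wonorm (recip \<mu>)
                 ((mat 1 - Pi_mat S \<mu>)
                  ** matrix_inv (mat 1 - wadjoint (recip \<mu>) (P_hat P \<mu>) ** P_hat P \<mu>)
                  ** (mat 1 - Pi_mat S \<mu>))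
       \<and> 1 - 1 / wonorm (recip \<mu>)
                 ((mat 1 - Pi_mat S \<mu>)
                  ** matrix_inv (mat 1 - wadjoint (recip \<mu>) (P_hat P \<mu>) ** P_hat P \<mu>)
                  ** (mat 1 - Pi_mat S \<mu>))
           \<le> 1 - 1 / ((sin \<theta>)\<^sup>2 * (1 / (1 - lam 2)) + (cos \<theta>)\<^sup>2 * (1 / (1 - lam (k + 1))))"
proof -
  have "\<mu> \<noteq> 0"
    using assms(5) by auto
  then have mu_pos: "0 < \<mu> $ x" for x
    using assms(1,2,4,6) by (intro stationary_positive)
  interpret coarse_chain_eigenbasis P \<mu> S lam v
    by unfold_locales (use assms mu_pos in auto)
  obtain a where a: "E *v a \<noteq> 0"
    using assms(8) E_nontrivial by blast
  let ?c = "wonorm (recip \<mu>) (E ** matrix_inv (gap K) ** E)"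
  have pos: "0 < ?c"
    by (rule compressed_inverse_wonorm_pos [OF P_hat_strict_contraction E_sym E_idem a])
  have "?c \<le> (sin \<theta>)\<^sup>2 * (1 / (1 - lam 2)) + (cos \<theta>)\<^sup>2 * (1 / (1 - lam (k + 1)))"
    using assms(11,12,15) by (rule wonorm_compressed_inverse_le_angle)
  with pos have "1 - 1 / ?c
      \<le> 1 - 1 / ((sin \<theta>)\<^sup>2 * (1 / (1 - lam 2)) + (cos \<theta>)\<^sup>2 * (1 / (1 - lam (k + 1))))"
    by (intro diff_left_mono divide_left_mono mult_pos_pos) auto
  with spectral_radius_J_le wonorm_J_le [OF a] show ?thesis
    unfolding gap_def by blast
qed

end
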